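(* Let $g$ lie in $\mathcal{C}^r\cap\mathcal{D}^p\cap\mathcal{K}^{\max\{p,r\}}$ for some $r,p\in\mathbb{N}$. The following assertions hold. (a) $\Sigma g$ lies in $\mathcal{C}^r\cap\mathcal{D}^{p+1}\cap\mathcal{K}^{\max\{p,r\}}$. (b) The sequence $n\mapsto D^rf^p_n[g]$ converges uniformly on any bounded subset of $\mathbb{R}_+$ to $D^r\Sigma g$.
   Context: $\mathbb{N}=\{0,1,2,\ldots\}$, $\mathbb{N}^*=\{1,2,\ldots\}$, $\mathbb{R}_+=(0,\infty)$, $\Delta f(x)=f(x+1)-f(x)$, $D$ is the derivative operator; $\mathcal{C}^r$ is the set of $r$ times continuously differentiable functions $\mathbb{R}_+\to\mathbb{R}$. For an integer $p\ge -1$, a function $f\colon I\to\mathbb{R}$ on a real interval $I$ is $p$-convex (resp. $p$-concave) if for all $x_0<\cdots<x_{p+1}$ in $I$ the divided difference $f[x_0,\ldots,x_{p+1}]$ is $\ge 0$ (resp. $\le 0$), where $f[x_0,\ldots,x_n]=\sum_{k=0}^n f(x_k)/\prod_{j\ne k}(x_k-x_j)$. $\mathcal{K}^p$ is the set of functions $\mathbb{R}_+\to\mathbb{R}$ that are $p$-convex on some $[a,\infty)$ or $p$-concave on some $[a,\infty)$; one has $\mathcal{K}^{p+1}\subset\mathcal{K}^p$. $\mathcal{D}^p$ is the set of $g\colon\mathbb{R}_+\to\mathbb{R}$ with $\Delta^pg(n)\to 0$ as $n\to\infty$ over the integers (for $g\in\mathcal{K}^p$ this is equivalent to $\Delta^pg(x)\to0$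 as $x\to\infty$ over the reals). For $n\in\mathbb{N}^*$, $$f^p_n[g](x)=-g(x)+\sum_{k=1}^{n-1}(g(k)-g(x+k))+\sum_{j=1}^p\binom{x}{j}\Delta^{j-1}g(n),\qquad x>0.$$ For $g\in\mathcal{D}^p\cap\mathcal{K}^p$, $\Sigma g=\lim_{n\to\infty}f^p_n[g]$ (pointwise on $\mathbb{R}_+$); the limit exists, does not depend on the choice of such $p$, and $\Sigma g$ is the unique solution $f\in\mathcal{K}^p$ of $\Delta f=g$ with $f(1)=0$. *)

theory Defs
  imports "HOL-Analysis.Analysis"
begin

(* A function from the positive reals to the reals is represented by a total function of type
   real => real.  All notions below only look at its values on {0<..}. *)

definition fdiff :: "(real \<Rightarrow> real) \<Rightarrow> real \<Rightarrow> real" where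
  "fdiff f x = f (x + 1) - f x"

(* On the open set {0<..}, the iterated two-sided derivatives depend only on the values of f there. *)
definition C_class :: "nat \<Rightarrow> (real \<Rightarrow> real) set" where
  "C_class r = {f. (\<forall>k<r. \<forall>x>0. (deriv ^^ k) f differentiable (at x)) \<and>
                   continuous_on {0<..} ((deriv ^^ r) f)}"

definition divided_difference :: "(real \<Rightarrow> real) \<Rightarrow> nat \<Rightarrow> (nat \<Rightarrow> real) \<Rightarrow> real" where
  "divided_difference f n x = (\<Sum>k\<le>n. f (x k) / (\<Prod>j\<in>{..n} - {k}. x k - x j))"

(* The notion also makes sense for p = -1 (nonnegativity); only p \<ge> 0 is covered here. *)
definition p_convex_on :: "nat \<Rightarrow> real set \<Rightarrow> (real \<Rightarrow> real) \<Rightarrow> bool" where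
  "p_convex_on p I f \<longleftrightarrow>
     (\<forall>x. strict_mono_on {..p + 1} x \<and> x ` {..p + 1} \<subseteq> I \<longrightarrow> divided_difference f (p + 1) x \<ge> 0)"

definition p_concave_on :: "nat \<Rightarrow> real set \<Rightarrow> (real \<Rightarrow> real) \<Rightarrow> bool" where
  "p_concave_on p I f \<longleftrightarrow>
     (\<forall>x. strict_mono_on {..p + 1} x \<and> x ` {..p + 1} \<subseteq> I \<longrightarrow> divided_difference f (p + 1) x \<le> 0)"

definition K_class :: "nat \<Rightarrow> (real \<Rightarrow> real) set" where
  "K_class p = {f. \<exists>a>0. p_convex_on p {a..} f \<or> p_concave_on p {a..} f}"

definition D_class :: "nat \<Rightarrow> (real \<Rightarrow> real) set" where
  "D_class p = {g. (\<lambda>n::nat. (fdiff ^^ p) g (real n)) \<longlonglongrightarrow> 0}"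

(* Intended for n \<ge> 1; the value at n = 0 plays no role in the limits below. *)
definition f_approx :: "nat \<Rightarrow> nat \<Rightarrow> (real \<Rightarrow> real) \<Rightarrow> real \<Rightarrow> real" where
  "f_approx p n g x =
     - g x + (\<Sum>k=1..<n. g (real k) - g (x + real k))
       + (\<Sum>j=1..p. (x gchoose j) * (fdiff ^^ (j - 1)) g (real n))"

(* Meant for g in the union of the sets D_class p \<inter> K_class p.  For such g the limit exists for
   every admissible p and does not depend on p, so the choice of p is immaterial. *)
definition Sigma_op :: "(real \<Rightarrow> real) \<Rightarrow> real \<Rightarrow> real" where
  "Sigma_op g x = lim (\<lambda>n. f_approx (SOME p. g \<in> D_class p \<inter> K_class p) n g x)"

end

theory Submission
  imports Defs "HOL-Computational_Algebra.Polynomial"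
begin

text \<open>
Consecutive approximations \<open>f\<^sup>p\<^sub>n[g]\<close> and \<open>f\<^sup>p\<^sub>n\<^sub>+\<^sub>1[g]\<close> differ by the error, at \<open>x\<close>, of
interpolating \<open>g(n + x)\<close> at \<open>x = 0, ..., p\<close> by a polynomial (\<open>approx_chain_eq_series\<close>).
So everything reduces to bounding this error and its derivatives of order \<open>k \<le> r\<close> by a summable
sequence, uniformly for \<open>x\<close> in a bounded set; Weierstrass' test then gives uniform convergence of all
these derivatives, and the limit is of class \<open>C\<^sup>r\<close> with the expected derivatives.

Raising the order of the approximation from \<open>p\<close> to \<open>m = max p r\<close> changes it only by finitely
many polynomials in \<open>x\<close> whose coefficients tend to \<open>0\<close> (\<open>approx_chain_change_order\<close>), and
\<open>D\<^sup>p \<subseteq> D\<^sup>m\<close>. Hence one may assume \<open>r \<le> p\<close>. The same remark shows that \<open>\<Sigma>g\<close> does not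
depend on the order chosen in its definition.

The bound (\<open>newton_error_bound\<close>) rests on two facts about divided differences. Let \<open>g\<close> be
\<open>p\<close>-convex near infinity; otherwise pass to \<open>-g\<close>. First, \<open>D\<^sup>kg\<close> is \<open>(p - k)\<close>-convex
(\<open>hconvex_deriv\<close>), hence its divided differences of order \<open>p - k\<close> increase with the nodes
(\<open>ddiff_mono_exchange\<close>). Secondly, by Rolle's theorem the \<open>k\<close>-th derivative of the error has
\<open>p - k + 1\<close> zeros in \<open>[0, p]\<close>, and over these zeros, translated by \<open>n\<close>, the divided
difference of \<open>D\<^sup>kg\<close> equals \<open>\<Delta>\<^sup>pg(n) / (p - k)!\<close> (\<open>ddiff_newton_nodes\<close>). Now
the error at \<open>x\<close> is a bounded product times the difference of two divided differences of
\<open>D\<^sup>kg\<close> over nodes in \<open>[n, n + c)\<close>, where \<open>c\<close> is an integer exceeding \<open>p\<close> and all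
\<open>x\<close> considered. By monotonicity both lie between \<open>\<Delta>\<^sup>pg(n - c) / (p - k)!\<close> and
\<open>\<Delta>\<^sup>pg(n + c) / (p - k)!\<close>, and the increments
\<open>\<Delta>\<^sup>pg(n + c) - \<Delta>\<^sup>pg(n - c)\<close> form a telescoping, convergent series.

The remaining assertions pass to the limit: the approximations satisfy \<open>\<Delta>f = g\<close> up to terms tending to
\<open>0\<close>, which puts \<open>\<Sigma>g\<close> into \<open>D\<^sup>p\<^sup>+\<^sup>1\<close>, and up to a polynomial of degree at most \<open>p\<close> they are
minus a sum of translates of \<open>g\<close>, which gives the convexity type of \<open>\<Sigma>g\<close>.
\<close>

section \<open>Divided differences over finite sets\<close>

text \<open>Indexing a divided difference by the set of its nodes builds in its symmetry in the nodes, so that a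
node can be exchanged without any bookkeeping of positions.\<close>
definition ddiff :: "(real \<Rightarrow> real) \<Rightarrow> real set \<Rightarrow> real" where
  "ddiff f A = (\<Sum>a\<in>A. f a / (\<Prod>b\<in>A - {a}. a - b))"

lemma ddiff_cong: "(\<And>x. x \<in> A \<Longrightarrow> f x = h x) \<Longrightarrow> ddiff f A = ddiff h A"
  by (simp add: ddiff_def)

lemma ddiff_uminus: "ddiff (\<lambda>x. - f x) A = - ddiff f A"
  by (simp add: ddiff_def sum_negf)

lemma ddiff_add: "ddiff (\<lambda>x. f x + h x) A = ddiff f A + ddiff h A"
  by (simp add: ddiff_def add_divide_distrib sum.distrib)

lemma ddiff_diff: "ddiff (\<lambda>x. f x - h x) A = ddiff f A - ddiff h A"
  by (simp add: ddiff_def diff_divide_distrib sum_subtractf)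

lemma ddiff_sum: "ddiff (\<lambda>x. \<Sum>i\<in>I. f i x) A = (\<Sum>i\<in>I. ddiff (f i) A)"
proof -
  have "ddiff (\<lambda>x. \<Sum>i\<in>I. f i x) A = (\<Sum>a\<in>A. \<Sum>i\<in>I. f i a / (\<Prod>b\<in>A - {a}. a - b))"
    by (simp add: ddiff_def sum_divide_distrib)
  also have "\<dots> = (\<Sum>i\<in>I. ddiff (f i) A)"
    by (subst sum.swap) (simp add: ddiff_def)
  finally show ?thesis .
qed

lemma ddiff_shift: "ddiff f ((+) t ` A) = ddiff (\<lambda>x. f (t + x)) A"
proof -
  have "(\<Prod>b\<in>(+) t ` A - {t + a}. t + a - b) = (\<Prod>b\<in>A - {a}. a - b)" for a
  proof -
    have "(+) t ` A - {t + a} = (+) t ` (A - {a})" by auto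
    then show ?thesis by (simp add: prod.reindex)
  qed
  then show ?thesis by (simp add: ddiff_def sum.reindex)
qed

lemma ddiff_insert:
  assumes "finite A" "a \<notin> A"
  shows "ddiff f (insert a A) = f a / (\<Prod>c\<in>A. a - c) + (\<Sum>c\<in>A. f c / ((c - a) * (\<Prod>d\<in>A - {c}. c - d)))"
proof -
  have 1: "insert a A - {a} = A" using assms by auto
  have 2: "(\<Prod>d\<in>insert a A - {c}. c - d) = (c - a) * (\<Prod>d\<in>A - {c}. c - d)" if "c \<in> A" for c
  proof -
    have "insert a A - {c} = insert a (A - {c})" using assms that by auto
    then show ?thesis using assms by simp
  qed
  show ?thesis using assms by (simp add: ddiff_def 1 2)
qed

text \<open>The fundamental identity, read as an exchange of one node: replacing \<open>a\<close> by \<open>b\<close> changes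
the divided difference by \<open>b - a\<close> times a divided difference of one order higher. The coefficients
of \<open>f c\<close> agree by partial fractions.\<close>
lemma ddiff_recursion:
  assumes "finite A" "a \<notin> A" "b \<notin> A" "a \<noteq> b"
  shows "(b - a) * ddiff f (insert a (insert b A)) = ddiff f (insert b A) - ddiff f (insert a A)"
proof -
  let ?P = "\<lambda>c. \<Prod>d\<in>A - {c}. c - d"
  have P: "?P c \<noteq> 0" if "c \<in> A" for c using assms by simp
  have Q: "(\<Prod>d\<in>A. a - d) \<noteq> 0" "(\<Prod>d\<in>A. b - d) \<noteq> 0" using assms by auto
  have 1: "(\<Prod>d\<in>insert b A - {c}. c - d) = (c - b) * ?P c" if "c \<in> A" for c
  proof -
    have "insert b A - {c} = insert b (A - {c})" using assms that by auto
    then show ?thesis using assms by simp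
  qed
  have 2: "insert b A - {b} = A" using assms by auto
  have "(b - a) * ddiff f (insert a (insert b A)) =
        (b - a) * (f a / ((a - b) * (\<Prod>d\<in>A. a - d)) + f b / ((b - a) * (\<Prod>d\<in>A. b - d))
        + (\<Sum>c\<in>A. f c / ((c - a) * ((c - b) * ?P c))))"
    using assms by (simp add: ddiff_insert[of "insert b A" a] 1 2)
  also have "\<dots> = - f a / (\<Prod>d\<in>A. a - d) + f b / (\<Prod>d\<in>A. b - d)
        + (\<Sum>c\<in>A. (b - a) * (f c / ((c - a) * ((c - b) * ?P c))))"
  proof -
    have "(b - a) * (u / ((a - b) * v)) = - u / v" "(b - a) * (u / ((b - a) * v)) = u / v" for u v
      using assms(4) by (cases "v = 0"; simp add: field_simps)+
    then show ?thesis by (simp only: distrib_left sum_distrib_left)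
  qed
  also have "(\<Sum>c\<in>A. (b - a) * (f c / ((c - a) * ((c - b) * ?P c)))) =
        (\<Sum>c\<in>A. f c / ((c - b) * ?P c) - f c / ((c - a) * ?P c))"
  proof (rule sum.cong)
    fix c assume "c \<in> A"
    then have "c - a \<noteq> 0" "c - b \<noteq> 0" using assms by auto
    moreover define u where "u = ?P c"
    moreover have "u \<noteq> 0" using P[OF \<open>c \<in> A\<close>] by (simp add: u_def)
    ultimately show "(b - a) * (f c / ((c - a) * ((c - b) * ?P c))) = f c / ((c - b) * ?P c) - f c / ((c - a) * ?P c)"
      unfolding u_def[symmetric] by (simp add: divide_simps) (simp add: algebra_simps)
  qed simp
  finally show ?thesis using assms by (simp add: ddiff_insert sum_subtractf)
qed

lemma ddiff_const:
  assumes "finite A" "card A \<ge> 2"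
  shows "ddiff (\<lambda>x. c) A = 0"
  using assms
proof (induction "card A" arbitrary: A rule: less_induct)
  case less
  obtain a A' where a: "A = insert a A'" "a \<notin> A'" "finite A'"
    using less.prems by (metis card_eq_0_iff finite_insert mk_disjoint_insert not_numeral_le_zero ex_in_conv)
  then obtain b B where b: "A' = insert b B" "b \<notin> B" "finite B"
    using less.prems by (metis card.empty card_insert_disjoint finite_insert mk_disjoint_insert
        not_less_eq_eq numeral_2_eq_2 ex_in_conv le0)
  have ab: "a \<noteq> b" "a \<notin> B" using a b by auto
  have "ddiff (\<lambda>x. c) (insert b B) = ddiff (\<lambda>x. c) (insert a B)"
  proof (cases "B = {}")
    case True
    then show ?thesis by (simp add: ddiff_def)
  next
    case False
    then have "card B \<ge> 1" using b by (simp add: Suc_le_eq card_gt_0_iff)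
    then show ?thesis using less.hyps[of "insert a B"] less.hyps[of "insert b B"] a b ab by simp
  qed
  then show ?case
    using ddiff_recursion[of B a b "\<lambda>x. c"] a b ab by simp
qed

lemma ddiff_insert_times:
  assumes "finite A" "a \<notin> A"
  shows "ddiff (\<lambda>x. (x - a) * f x) (insert a A) = ddiff f A"
  using assms by (auto simp: ddiff_insert) (auto simp: ddiff_def intro!: sum.cong)

text \<open>On \<open>n + 1\<close> nodes the divided difference reads off the coefficient of \<open>x ^ n\<close>. Dividing by
\<open>x - a\<close> for a node \<open>a\<close> removes that node and lowers the degree by one, while the remainder
is a constant and contributes nothing.\<close>
lemma ddiff_poly:
  assumes "finite A" "card A = Suc n" "degree P \<le> n"
  shows "ddiff (poly P) A = coeff P n"
  using assms
proof (induction n arbitrary: A P)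
  case 0
  then obtain a where "A = {a}" by (auto simp: card_1_singleton_iff)
  moreover obtain c where "P = [:c:]" using 0 degree_eq_zeroE by auto
  ultimately show ?case by (simp add: ddiff_def)
next
  case (Suc n)
  obtain a B where a: "A = insert a B" "a \<notin> B" "finite B"
    using Suc.prems by (metis card_eq_SucD finite_insert)
  have cB: "card B = Suc n" using a Suc.prems by simp
  define Q where "Q = synthetic_div P a"
  have dQ: "degree Q \<le> n" using Suc.prems by (simp add: Q_def degree_synthetic_div)
  have P: "P = [:- a, 1:] * Q + [:poly P a:]"
    by (simp only: Q_def synthetic_div_correct')
  have "ddiff (poly P) A = ddiff (\<lambda>x. (x - a) * poly Q x + poly P a) A"
    by (rule ddiff_cong) (subst P, simp add: algebra_simps)
  also have "\<dots> = ddiff (\<lambda>x. (x - a) * poly Q x) A + ddiff (\<lambda>x. poly P a) A"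
    by (rule ddiff_add)
  also have "ddiff (\<lambda>x. poly P a) A = 0"
    using Suc.prems by (intro ddiff_const) auto
  also have "ddiff (\<lambda>x. (x - a) * poly Q x) A = ddiff (poly Q) B"
    using a by (simp add: ddiff_insert_times)
  also have "\<dots> = coeff Q n" using Suc.IH[OF a(3) cB dQ] .
  also have "coeff Q n = coeff P (Suc n)"
    using dQ by (subst P) (simp add: coeff_eq_0)
  finally show ?case by simp
qed

lemma ddiff_poly_eq_0:
  assumes "finite A" "card A = n + 2" "degree P \<le> n"
  shows "ddiff (poly P) A = 0"
  using ddiff_poly[of A "Suc n" P] assms by (simp add: coeff_eq_0)

lemma divided_difference_eq_ddiff:
  assumes "inj_on x {..n}"
  shows "divided_difference f n x = ddiff f (x ` {..n})"
proof -
  have "(\<Prod>j\<in>{..n} - {k}. x k - x j) = (\<Prod>b\<in>x ` {..n} - {x k}. x k - b)" if "k \<le> n" for k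
  proof -
    have "x ` {..n} - {x k} = x ` ({..n} - {k})"
      using assms that by (auto simp: inj_on_def)
    moreover have "inj_on x ({..n} - {k})" using assms by (rule inj_on_subset) auto
    ultimately show ?thesis by (simp add: prod.reindex)
  qed
  then show ?thesis using assms by (simp add: divided_difference_def ddiff_def sum.reindex)
qed

section \<open>Higher-order convexity\<close>

text \<open>The \<open>p\<close>-convexity of the theorem, phrased with sets of nodes;
\<open>p\<close>-concavity is \<open>p\<close>-convexity of the negated function.\<close>
definition hconvex :: "nat \<Rightarrow> real set \<Rightarrow> (real \<Rightarrow> real) \<Rightarrow> bool" where
  "hconvex p I f \<longleftrightarrow> (\<forall>A\<subseteq>I. finite A \<and> card A = p + 2 \<longrightarrow> 0 \<le> ddiff f A)"

lemma finite_set_enumeration: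
  fixes A :: "real set"
  assumes "finite A" "card A = Suc n"
  obtains x where "strict_mono_on {..n} x" "x ` {..n} = A"
proof
  let ?l = "sorted_list_of_set A"
  have l: "length ?l = Suc n" "set ?l = A" using assms by auto
  show "strict_mono_on {..n} ((!) ?l)"
    using l by (auto intro!: strict_mono_onI sorted_wrt_nth_less[OF strict_sorted_list_of_set])
  show "(!) ?l ` {..n} = A"
    using l by (metis atLeast0AtMost atLeast0LessThan lessThan_Suc_atMost list.set_map map_nth set_upt)
qed

lemma p_convex_on_iff_hconvex: "p_convex_on p I f \<longleftrightarrow> hconvex p I f"
proof
  assume c: "p_convex_on p I f"
  show "hconvex p I f"
    unfolding hconvex_def
  proof safe
    fix A assume A: "A \<subseteq> I" "finite A" "card A = p + 2"
    obtain x where x: "strict_mono_on {..p+1} x" "x ` {..p+1} = A"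
      using finite_set_enumeration[of A "p+1"] A by auto
    then show "0 \<le> ddiff f A"
      using c A unfolding p_convex_on_def
      by (metis divided_difference_eq_ddiff strict_mono_on_imp_inj_on)
  qed
next
  assume c: "hconvex p I f"
  show "p_convex_on p I f"
    unfolding p_convex_on_def
  proof safe
    fix x :: "nat \<Rightarrow> real" assume x: "strict_mono_on {..p+1} x" "x ` {..p+1} \<subseteq> I"
    then have "inj_on x {..p+1}" by (simp add: strict_mono_on_imp_inj_on)
    then show "0 \<le> divided_difference f (p+1) x"
      using c x unfolding hconvex_def
      by (simp add: divided_difference_eq_ddiff card_image)
  qed
qed

lemma p_concave_on_iff_hconvex: "p_concave_on p I f \<longleftrightarrow> hconvex p I (\<lambda>x. - f x)"
proof -
  have "divided_difference (\<lambda>x. - f x) n x = - divided_difference f n x" for n x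
    by (simp add: divided_difference_def sum_negf)
  then show ?thesis
    unfolding p_convex_on_iff_hconvex[symmetric] p_convex_on_def p_concave_on_def by simp
qed

lemma K_class_iff_hconvex:
  "f \<in> K_class p \<longleftrightarrow> (\<exists>a>0. hconvex p {a..} f \<or> hconvex p {a..} (\<lambda>x. - f x))"
  by (simp add: K_class_def p_convex_on_iff_hconvex p_concave_on_iff_hconvex)

text \<open>Exchanging one node \<open>a\<close> for a larger \<open>\<sigma> a\<close> raises a divided difference of order
\<open>q\<close>, by the exchange identity and the sign of the divided differences of order \<open>q + 1\<close>. The
nodes of \<open>A\<close> are exchanged one at a time; \<open>C\<close> collects the nodes that stay, among them
those already exchanged, and the order in which the nodes are treated is immaterial.\<close>
lemma ddiff_mono_exchange:
  assumes "hconvex q I f" "finite A" "finite C" "card A + card C = q + 1"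
    and "inj_on \<sigma> A" "\<sigma> ` A \<inter> A = {}" "\<And>a. a \<in> A \<Longrightarrow> a < \<sigma> a"
    and "C \<inter> A = {}" "C \<inter> \<sigma> ` A = {}" "A \<union> C \<union> \<sigma> ` A \<subseteq> I"
  shows "ddiff f (A \<union> C) \<le> ddiff f (\<sigma> ` A \<union> C)"
  using assms(2-)
proof (induction A arbitrary: C rule: finite_induct)
  case (insert a A)
  let ?B = "A \<union> C"
  have na: "a \<notin> ?B" "\<sigma> a \<notin> ?B" "a < \<sigma> a" using insert by auto
  have card: "card (insert a (insert (\<sigma> a) ?B)) = q + 2"
  proof -
    have "card ?B = card A + card C" using insert by (intro card_Un_disjoint) auto
    then show ?thesis using na insert by (auto simp: card_insert_if)
  qed
  have "0 \<le> ddiff f (insert a (insert (\<sigma> a) ?B))"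
  proof -
    have "insert a (insert (\<sigma> a) ?B) \<subseteq> I" using insert.prems by auto
    then show ?thesis using assms(1) card insert unfolding hconvex_def by auto
  qed
  then have "0 \<le> (\<sigma> a - a) * ddiff f (insert a (insert (\<sigma> a) ?B))"
    using na by simp
  then have "ddiff f (insert a ?B) \<le> ddiff f (insert (\<sigma> a) ?B)"
    using ddiff_recursion[of ?B a "\<sigma> a" f] na insert by auto
  also have "insert (\<sigma> a) ?B = A \<union> insert (\<sigma> a) C" by auto
  also have "ddiff f (A \<union> insert (\<sigma> a) C) \<le> ddiff f (\<sigma> ` A \<union> insert (\<sigma> a) C)"
  proof (rule insert.IH)
    have "\<sigma> a \<notin> \<sigma> ` A" using insert by (auto simp: inj_on_def)
    then show "insert (\<sigma> a) C \<inter> \<sigma> ` A = {}" using insert.prems by auto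
    have "\<sigma> a \<notin> C" using insert by auto
    then show "card A + card (insert (\<sigma> a) C) = q + 1" using insert by simp
    show "insert (\<sigma> a) C \<inter> A = {}" "\<sigma> ` A \<inter> A = {}" "inj_on \<sigma> A" "A \<union> insert (\<sigma> a) C \<union> \<sigma> ` A \<subseteq> I"
      using insert.prems by auto
  qed (use insert in auto)
  finally show ?case by simp
qed simp

lemma ddiff_mono_separated:
  assumes "hconvex q I f" "finite A" "finite B" "card A = q + 1" "card B = q + 1"
    and "A \<subseteq> I" "B \<subseteq> I" "\<And>a b. a \<in> A \<Longrightarrow> b \<in> B \<Longrightarrow> a < b"
  shows "ddiff f A \<le> ddiff f B"
proof -
  obtain \<sigma> where s: "bij_betw \<sigma> A B"
    using assms by (metis bij_betw_iff_card)
  then have "\<sigma> ` A = B" "inj_on \<sigma> A" by (auto simp: bij_betw_def)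
  moreover have "B \<inter> A = {}" using assms(8) by blast
  moreover have "a < \<sigma> a" if "a \<in> A" for a using s assms(8) that by (auto simp: bij_betw_def)
  ultimately show ?thesis
    using ddiff_mono_exchange[of q I f A "{}" \<sigma>] assms by auto
qed

text \<open>Translating all nodes of a set \<open>A\<close> by \<open>t\<close> gives a function of \<open>t\<close> whose derivative at
\<open>0\<close> is the divided difference of \<open>f'\<close> over \<open>A\<close>. By monotonicity in the nodes it does not
drop when \<open>t\<close> moves to the right of \<open>0\<close>, hence this derivative is nonnegative.\<close>
lemma hconvex_deriv:
  assumes f: "hconvex (Suc q) {a<..} f"
    and d: "\<And>x. x > a \<Longrightarrow> (f has_real_derivative f' x) (at x)"
  shows "hconvex q {a<..} f'"
  unfolding hconvex_def
proof safe
  fix A assume A: "A \<subseteq> {a<..}" "finite A" "card A = q + 2"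
  define \<phi> where "\<phi> t = (\<Sum>x\<in>A. f (t + x) / (\<Prod>b\<in>A - {x}. x - b))" for t
  have \<phi>: "\<phi> t = ddiff f ((+) t ` A)" for t
    by (simp add: \<phi>_def ddiff_shift) (simp add: ddiff_def)
  have "(\<phi> has_real_derivative ddiff f' A) (at 0)"
    unfolding \<phi>_def ddiff_def
  proof (intro DERIV_sum DERIV_cdivide)
    fix x assume "x \<in> A"
    then have "(f has_real_derivative f' x) (at (0 + x))" using A d by auto
    then show "((\<lambda>t. f (t + x)) has_real_derivative f' x) (at 0)"
      using DERIV_shift[of f "f' x" 0 x] by simp
  qed
  show "0 \<le> ddiff f' A"
  proof (rule ccontr)
    assume "\<not> 0 \<le> ddiff f' A"
    then obtain e where e: "e > 0" "\<And>h. 0 < h \<Longrightarrow> h < e \<Longrightarrow> \<phi> (0 + h) < \<phi> 0"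
      using DERIV_neg_dec_right[OF \<open>(\<phi> has_real_derivative ddiff f' A) (at 0)\<close>] by auto
    \<comment> \<open>The exchange needs the translated set to be disjoint from \<open>A\<close>; only finitely many \<open>t\<close>,
the differences of two nodes, violate this.\<close>
    have "infinite ({0<..<e} - (\<lambda>(x, y). x - y) ` (A \<times> A))"
      using e A by (intro Diff_infinite_finite) auto
    then obtain t where t: "0 < t" "t < e" "t \<notin> (\<lambda>(x, y). x - y) ` (A \<times> A)"
      by (metis (no_types, lifting) Diff_iff finite.emptyI greaterThanLessThan_iff ex_in_conv)
    have disj: "(+) t ` A \<inter> A = {}"
    proof (rule ccontr)
      assume "(+) t ` A \<inter> A \<noteq> {}"
      then obtain x where "x \<in> A" "t + x \<in> A" by auto
      then have "t \<in> (\<lambda>(x, y). x - y) ` (A \<times> A)" by (intro image_eqI[of _ _ "(t + x, x)"]) auto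
      then show False using t by simp
    qed
    have "ddiff f (A \<union> {}) \<le> ddiff f ((+) t ` A \<union> {})"
      using A t disj by (intro ddiff_mono_exchange[OF f]) auto
    then show False using e(2)[OF t(1,2)] by (simp add: \<phi>)
  qed
qed

lemma hconvex_subset: "hconvex q I f \<Longrightarrow> J \<subseteq> I \<Longrightarrow> hconvex q J f"
  unfolding hconvex_def by blast

lemma hconvex_higher_deriv:
  assumes "hconvex p {a<..} (G 0)" "k \<le> p"
    and "\<And>j x. j < k \<Longrightarrow> x > a \<Longrightarrow> (G j has_real_derivative G (Suc j) x) (at x)"
  shows "hconvex (p - k) {a<..} (G k)"
  using assms(2,3)
proof (induction k)
  case 0
  then show ?case using assms by simp
next
  case (Suc k)
  have "hconvex (Suc (p - Suc k)) {a<..} (G k)"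
    using Suc by (simp add: Suc_diff_Suc)
  then show ?case by (rule hconvex_deriv) (use Suc in auto)
qed

section \<open>Newton interpolation at consecutive integers\<close>

definition gbinomial_poly :: "nat \<Rightarrow> real poly" where
  "gbinomial_poly j = smult (1 / fact j) (\<Prod>i<j. [:- real i, 1:])"

lemma poly_gbinomial_poly: "poly (gbinomial_poly j) x = x gchoose j"
  by (simp add: gbinomial_poly_def poly_prod gbinomial_prod_rev atLeast0LessThan)

lemma degree_gbinomial_poly: "degree (gbinomial_poly j) = j"
  and coeff_gbinomial_poly: "coeff (gbinomial_poly j) j = 1 / fact j"
proof -
  have d: "degree (\<Prod>i<j. [:- real i, 1:]) = j"
    by (subst degree_prod_sum_eq) auto
  show "degree (gbinomial_poly j) = j"
    by (simp add: gbinomial_poly_def d)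
  have "coeff (\<Prod>i<j. [:- real i, 1:]) j = lead_coeff (\<Prod>i<j. [:- real i, 1:])"
    by (simp add: d)
  also have "\<dots> = 1" by (simp add: lead_coeff_prod del: prod.lessThan_Suc)
  finally show "coeff (gbinomial_poly j) j = 1 / fact j"
    by (simp add: gbinomial_poly_def)
qed

text \<open>The polynomial of degree at most \<open>p\<close> in \<open>x\<close> that interpolates \<open>f (t + x)\<close> at
\<open>x = 0, 1, ..., p\<close>, in Newton's forward form.\<close>
definition newton_poly :: "nat \<Rightarrow> (real \<Rightarrow> real) \<Rightarrow> real \<Rightarrow> real poly" where
  "newton_poly p f t = (\<Sum>j\<le>p. smult ((fdiff ^^ j) f t) (gbinomial_poly j))"

lemma degree_newton_poly: "degree (newton_poly p f t) \<le> p"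
  unfolding newton_poly_def
  by (intro degree_sum_le) (auto intro: order.trans[OF degree_smult_le] simp: degree_gbinomial_poly)

lemma coeff_newton_poly: "coeff (newton_poly p f t) p = (fdiff ^^ p) f t / fact p"
proof -
  have "coeff (newton_poly p f t) p = (\<Sum>j\<le>p. (fdiff ^^ j) f t * coeff (gbinomial_poly j) p)"
    by (simp add: newton_poly_def coeff_sum)
  also have "\<dots> = (\<Sum>j\<in>{p}. (fdiff ^^ j) f t * coeff (gbinomial_poly j) p)"
    by (intro sum.mono_neutral_right) (auto intro!: coeff_eq_0 simp: degree_gbinomial_poly)
  finally show ?thesis by (simp add: coeff_gbinomial_poly)
qed

lemma fdiff_Suc_add: "(fdiff ^^ j) f (t + 1) = (fdiff ^^ j) f t + (fdiff ^^ Suc j) f t"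
  by (simp add: fdiff_def)

text \<open>This is \<open>(1 + \<Delta>) ^ i\<close> expanded by the binomial theorem.\<close>
lemma newton_forward: "f (t + real i) = (\<Sum>j\<le>i. real (i choose j) * (fdiff ^^ j) f t)"
proof (induction i arbitrary: t)
  case (Suc i)
  let ?D = "\<lambda>j. (fdiff ^^ j) f t"
  have "f (t + real (Suc i)) = f ((t + 1) + real i)" by (simp add: algebra_simps)
  also have "\<dots> = (\<Sum>j\<le>i. real (i choose j) * (?D j + ?D (Suc j)))"
    by (subst Suc) (simp only: fdiff_Suc_add)
  also have "\<dots> = (\<Sum>j\<le>i. real (i choose j) * ?D j) + (\<Sum>j\<le>i. real (i choose j) * ?D (Suc j))"
    by (simp only: distrib_left sum.distrib)
  also have "(\<Sum>j\<le>i. real (i choose j) * ?D j) = (\<Sum>j\<le>Suc i. real (i choose j) * ?D j)"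
    by (simp add: binomial_eq_0)
  also have "\<dots> = ?D 0 + (\<Sum>j\<le>i. real (i choose Suc j) * ?D (Suc j))"
    by (subst sum.atMost_Suc_shift) simp
  also have "\<dots> + (\<Sum>j\<le>i. real (i choose j) * ?D (Suc j)) = 
      ?D 0 + (\<Sum>j\<le>i. real (Suc i choose Suc j) * ?D (Suc j))"
    by (simp add: sum.distrib[symmetric] algebra_simps del: funpow.simps)
  also have "\<dots> = (\<Sum>j\<le>Suc i. real (Suc i choose j) * ?D j)"
    by (subst sum.atMost_Suc_shift) simp
  finally show ?case .
qed simp

lemma poly_newton_poly: "poly (newton_poly p f t) x = (\<Sum>j\<le>p. (x gchoose j) * (fdiff ^^ j) f t)"
  by (simp add: newton_poly_def poly_sum poly_gbinomial_poly mult.commute)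

lemma newton_poly_interpolates:
  assumes "i \<le> p"
  shows "poly (newton_poly p f t) (real i) = f (t + real i)"
proof -
  have "(\<Sum>j\<le>p. (real i gchoose j) * (fdiff ^^ j) f t) = (\<Sum>j\<le>i. real (i choose j) * (fdiff ^^ j) f t)"
    using assms by (intro sum.mono_neutral_cong_right) (auto simp: binomial_gbinomial[symmetric] binomial_eq_0)
  then show ?thesis by (simp add: poly_newton_poly newton_forward)
qed

text \<open>Between any two neighbouring zeros of \<open>h\<close> there is one of \<open>h'\<close>. The induction adds the zeros
of \<open>h\<close> from left to right and keeps the zeros of \<open>h'\<close> below the largest one, so that each
new zero is distinct from the earlier ones.\<close>
lemma Rolle_zeros:
  fixes h h' :: "real \<Rightarrow> real"
  assumes "finite Z" "card Z = Suc m" "Z \<subseteq> {u..v}" "\<And>z. z \<in> Z \<Longrightarrow> h z = 0"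
    and "\<And>x. x \<in> {u..v} \<Longrightarrow> (h has_real_derivative h' x) (at x)"
  obtains Z' where "finite Z'" "card Z' = m" "Z' \<subseteq> {u..v}" "\<And>z. z \<in> Z' \<Longrightarrow> h' z = 0"
proof -
  have "\<exists>Z'. finite Z' \<and> Suc (card Z') = card Z \<and> (\<forall>z\<in>Z'. u \<le> z \<and> z < Max Z \<and> h' z = 0)"
    if "finite Z" "Z \<noteq> {}" "Z \<subseteq> {u..v}" "\<And>z. z \<in> Z \<Longrightarrow> h z = 0" for Z
    using that
  proof (induction Z rule: finite_linorder_max_induct)
    case (insert b A)
    show ?case
    proof (cases "A = {}")
      case True
      then show ?thesis by (intro exI[of _ "{}"]) auto
    next
      case False
      then obtain Z' where Z': "finite Z'" "Suc (card Z') = card A"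
          "\<forall>z\<in>Z'. u \<le> z \<and> z < Max A \<and> h' z = 0"
        using insert by auto
      have M: "Max A \<in> A" "Max A < b" using False insert by auto
      have uv: "u \<le> Max A" "b \<le> v" using insert.prems M by auto
      have "\<exists>z. Max A < z \<and> z < b \<and> DERIV h z :> 0"
      proof (rule Rolle)
        show "h (Max A) = h b" using insert.prems M by simp
        show "continuous_on {Max A..b} h"
          using uv by (intro DERIV_continuous_on[where D = h'] DERIV_subset[OF assms(5)]) auto
        show "h differentiable (at x)" if "Max A < x" "x < b" for x
          using assms(5)[of x] uv that by (auto simp: real_differentiable_def)
      qed (use M in auto)
      then obtain z where z: "Max A < z" "z < b" "DERIV h z :> 0" by blast
      have "h' z = 0"
        using DERIV_unique[OF assms(5)[of z] z(3)] z uv by auto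
      moreover have "z \<notin> Z'" using Z' z by force
      moreover have "Max (insert b A) = b" using False insert M by (intro Max_eqI) auto
      moreover have "\<forall>y\<in>Z'. u \<le> y \<and> y < b \<and> h' y = 0" using Z'(3) M by auto
      moreover have "b \<notin> A" using insert.hyps by auto
      ultimately show ?thesis
        using Z'(1,2) z uv insert.hyps(1) by (intro exI[of _ "insert z Z'"]) auto
    qed
  qed simp
  from this[of Z] obtain Z' where Z': "finite Z'" "Suc (card Z') = card Z" 
    "\<forall>z\<in>Z'. u \<le> z \<and> z < Max Z \<and> h' z = 0"
    using assms by force
  moreover have "Max Z \<in> {u..v}" 
  proof -
    have "Z \<noteq> {}" using assms(2) by auto
    then show ?thesis using assms(1,3) Max_in[of Z] by blast
  qed
  ultimately show ?thesis using assms(2) by (intro that[of Z']) auto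
qed

section \<open>Chains of derivatives\<close>

text \<open>A function together with its first \<open>r\<close> derivatives, given as a family. The families that occur
below are explicit sums or series, and this form lets their derivatives be named before they are known
to be iterated values of \<^const>\<open>deriv\<close>.\<close>
definition deriv_chain :: "nat \<Rightarrow> (nat \<Rightarrow> real \<Rightarrow> real) \<Rightarrow> bool" where
  "deriv_chain r G \<longleftrightarrow> (\<forall>k<r. \<forall>x>0. (G k has_real_derivative G (Suc k) x) (at x))"

lemma deriv_chainD: "deriv_chain r G \<Longrightarrow> k < r \<Longrightarrow> x > 0 \<Longrightarrow> (G k has_real_derivative G (Suc k) x) (at x)"
  by (simp add: deriv_chain_def)

lemma deriv_chain_mono: "deriv_chain r G \<Longrightarrow> k \<le> r \<Longrightarrow> deriv_chain k G"
  by (simp add: deriv_chain_def)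

lemma deriv_chain_uminus: "deriv_chain r G \<Longrightarrow> deriv_chain r (\<lambda>k x. - G k x)"
  unfolding deriv_chain_def by (auto intro: DERIV_minus)

lemma higher_deriv_eq_chain:
  assumes "deriv_chain r F" "\<And>x. x > 0 \<Longrightarrow> f x = F 0 x" "k \<le> r" "x > 0"
  shows "(deriv ^^ k) f x = F k x"
  using assms(3,4)
proof (induction k arbitrary: x)
  case (Suc k)
  have "(F k has_real_derivative F (Suc k) x) (at x)"
    using Suc.prems by (intro deriv_chainD[OF assms(1)]) auto
  then have "((deriv ^^ k) f has_real_derivative F (Suc k) x) (at x)"
    by (rule has_field_derivative_transform_within_open[where S = "{0<..}"]) (use Suc in auto)
  then show ?case by (simp add: DERIV_imp_deriv)
qed (use assms in auto)

lemma deriv_chain_higher_deriv: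
  assumes "g \<in> C_class r"
  shows "deriv_chain r (\<lambda>k. (deriv ^^ k) g)"
  using assms by (simp add: C_class_def deriv_chain_def DERIV_deriv_iff_real_differentiable)

lemma C_class_chainI:
  assumes "deriv_chain r F" "continuous_on {0<..} (F r)" "\<And>x. x > 0 \<Longrightarrow> f x = F 0 x"
  shows "f \<in> C_class r"
  unfolding C_class_def
proof safe
  have eq: "(deriv ^^ k) f x = F k x" if "k \<le> r" "x > 0" for k x
    using higher_deriv_eq_chain[OF assms(1,3)] that by blast
  show "(deriv ^^ k) f differentiable (at x)" if "k < r" "x > 0" for k x
  proof -
    have "((deriv ^^ k) f has_real_derivative F (Suc k) x) (at x)"
      by (rule has_field_derivative_transform_within_open[OF deriv_chainD[OF assms(1) that], where S = "{0<..}"])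
        (use that eq in auto)
    then show ?thesis by (auto simp: real_differentiable_def)
  qed
  show "continuous_on {0<..} ((deriv ^^ r) f)"
    using assms(2) by (rule continuous_on_eq) (simp add: eq)
qed

section \<open>The error of Newton interpolation and its derivatives\<close>

text \<open>The \<open>k\<close>-th derivative in \<open>x\<close> of the error made by interpolating \<open>G 0 (t + x)\<close> at
\<open>x = 0, 1, ..., p\<close>.\<close>
definition newton_error :: "nat \<Rightarrow> (nat \<Rightarrow> real \<Rightarrow> real) \<Rightarrow> nat \<Rightarrow> real \<Rightarrow> real \<Rightarrow> real" where
  "newton_error p G k t x = G k (t + x) - poly ((pderiv ^^ k) (newton_poly p (G 0) t)) x"

lemma fdiff_funpow_uminus: "(fdiff ^^ j) (\<lambda>x. - f x) t = - (fdiff ^^ j) f t"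
  by (induction j arbitrary: t) (simp_all add: fdiff_def)

lemma newton_error_uminus: "newton_error p (\<lambda>k x. - G k x) k t x = - newton_error p G k t x"
proof -
  have "newton_poly p (\<lambda>x. - G 0 x) t = smult (-1) (newton_poly p (G 0) t)"
    by (simp add: newton_poly_def fdiff_funpow_uminus sum_negf)
  then show ?thesis
    by (simp add: newton_error_def higher_pderiv_smult del: smult_minus_left)
qed

lemma newton_error_deriv:
  assumes "deriv_chain r G" "k < r" "t + x > 0"
  shows "(newton_error p G k t has_real_derivative newton_error p G (Suc k) t x) (at x)"
proof -
  have "((\<lambda>x. G k (x + t)) has_real_derivative G (Suc k) (x + t)) (at x)"
    using deriv_chainD[OF assms(1,2), of "x + t"] assms(3) DERIV_shift[of "G k" _ x t] by (simp add: add.commute)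
  then show ?thesis
    unfolding newton_error_def[abs_def]
    by (auto intro!: DERIV_diff poly_DERIV simp: add.commute)
qed

text \<open>The error vanishes at \<open>p + 1\<close> points, and each derivative loses at most one zero.\<close>
lemma newton_error_zeros:
  assumes "deriv_chain k G" "k \<le> p" "t > 0"
  shows "\<exists>Z. finite Z \<and> card Z = Suc (p - k) \<and> Z \<subseteq> {0..real p} \<and> (\<forall>z\<in>Z. newton_error p G k t z = 0)"
  using assms(1,2)
proof (induction k)
  case 0
  have "newton_error p G 0 t (real i) = 0" if "i \<le> p" for i
    using that by (simp add: newton_error_def newton_poly_interpolates)
  then show ?case
    by (intro exI[of _ "real ` {..p}"]) (auto simp: card_image)
next
  case (Suc k)
  then obtain Z where Z: "finite Z" "card Z = Suc (p - k)" "Z \<subseteq> {0..real p}"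
      "\<forall>z\<in>Z. newton_error p G k t z = 0"
    using deriv_chain_mono[of "Suc k" G k] by auto
  obtain Z' where "finite Z'" "card Z' = p - k" "Z' \<subseteq> {0..real p}" "\<And>z. z \<in> Z' \<Longrightarrow> newton_error p G (Suc k) t z = 0"
  proof (rule Rolle_zeros[OF Z(1-3)])
    show "(newton_error p G k t has_real_derivative newton_error p G (Suc k) t x) (at x)"
      if "x \<in> {0..real p}" for x
      using that assms(3) Suc.prems by (intro newton_error_deriv) auto
  qed (use Z in auto)
  then show ?case using Suc.prems by (intro exI[of _ Z']) (auto simp: Suc_diff_Suc)
qed

lemma ddiff_newton_poly_deriv:
  assumes "k \<le> p" "finite A" "card A = Suc (p - k)"
  shows "ddiff (poly ((pderiv ^^ k) (newton_poly p f t))) A = (fdiff ^^ p) f t / fact (p - k)"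
proof -
  have "ddiff (poly ((pderiv ^^ k) (newton_poly p f t))) A = coeff ((pderiv ^^ k) (newton_poly p f t)) (p - k)"
    using assms degree_newton_poly[of p f t] by (intro ddiff_poly) (auto simp: degree_higher_pderiv)
  also have "\<dots> = pochhammer (real (Suc (p - k))) k * ((fdiff ^^ p) f t / fact p)"
    using assms by (simp add: coeff_higher_pderiv coeff_newton_poly del: of_nat_Suc)
  also have "pochhammer (real (Suc (p - k))) k = fact p / fact (p - k)"
  proof -
    have "fact p = fact (p - k) * pochhammer (real (Suc (p - k))) k"
      using assms(1) pochhammer_product'[of "1::real" "p - k" k] by (simp add: pochhammer_fact add.commute)
    then show ?thesis by simp
  qed
  finally show ?thesis by simp
qed

text \<open>At the zeros of the \<open>k\<close>-th derivative of the error, \<open>G k (t + x)\<close> agrees with a polynomial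
in \<open>x\<close> of degree at most \<open>p - k\<close> with known leading coefficient. Translated by \<open>t\<close>, these zeros are thus
\<open>p - k + 1\<close> nodes in \<open>[t, t + p]\<close> over which the divided difference of \<open>G k\<close> is a fixed multiple of
\<open>\<Delta>\<^sup>p g(t)\<close>: the derivative \<open>G k\<close> is compared with differences of \<open>g = G 0\<close> itself.\<close>
lemma ddiff_newton_nodes:
  assumes "deriv_chain k G" "k \<le> p" "t > 0"
  obtains Z where "finite Z" "card Z = Suc (p - k)" "Z \<subseteq> {0..real p}"
    "\<And>z. z \<in> Z \<Longrightarrow> newton_error p G k t z = 0"
    "ddiff (G k) ((+) t ` Z) = (fdiff ^^ p) (G 0) t / fact (p - k)"
proof -
  obtain Z where Z: "finite Z" "card Z = Suc (p - k)" "Z \<subseteq> {0..real p}"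
    "\<And>z. z \<in> Z \<Longrightarrow> newton_error p G k t z = 0"
    using newton_error_zeros[OF assms] by blast
  have "ddiff (G k) ((+) t ` Z) = ddiff (poly ((pderiv ^^ k) (newton_poly p (G 0) t))) Z"
    unfolding ddiff_shift by (rule ddiff_cong) (use Z(4) in \<open>simp add: newton_error_def\<close>)
  then show ?thesis
    using that[OF Z] ddiff_newton_poly_deriv[OF assms(2) Z(1,2)] by simp
qed

text \<open>Let \<open>Z\<close> be the set of zeros of the \<open>k\<close>-th derivative of the error. For \<open>x\<close> outside
\<open>Z\<close>, exchange one zero for \<open>x\<close>. Up to sign, this derivative at \<open>x\<close> is then the product of the distances
from \<open>x\<close> to the remaining zeros, times the change that the exchange causes in the divided difference of
\<open>G k\<close>. Both values of this divided difference are over nodes in \<open>[t, t + c)\<close>. As \<open>G k\<close>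
is \<open>(p - k)\<close>-convex, they lie between the values over the special nodes belonging to \<open>t - c\<close>,
which are all smaller, and to \<open>t + c\<close>, which are all larger.\<close>
lemma newton_error_bound:
  fixes c :: nat
  assumes G: "deriv_chain k G" "k \<le> p" and conv: "hconvex p {a<..} (G 0)"
    and a: "a \<ge> 0" "a + real c < t" and c: "p < c" and x: "0 \<le> x" "x < real c"
  shows "\<bar>newton_error p G k t x\<bar> \<le>
    real c ^ (p - k) / fact (p - k) * ((fdiff ^^ p) (G 0) (t + real c) - (fdiff ^^ p) (G 0) (t - real c))"
proof -
  define q where "q = p - k"
  define T where "T s = (fdiff ^^ p) (G 0) s / fact q" for s
  have qc: "hconvex q {a<..} (G k)"
    unfolding q_def using conv G(2)
  proof (rule hconvex_higher_deriv)
    show "(G j has_real_derivative G (Suc j) x) (at x)" if "j < k" "a < x" for j x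
      using deriv_chainD[OF G(1)] that a by auto
  qed
  have pos: "t - real c > 0" "t > 0" "t + real c > 0" using a by auto
  obtain Z where Z: "finite Z" "card Z = Suc q" "Z \<subseteq> {0..real p}"
    "\<And>z. z \<in> Z \<Longrightarrow> newton_error p G k t z = 0" "ddiff (G k) ((+) t ` Z) = T t"
    using ddiff_newton_nodes[OF G pos(2)] unfolding T_def q_def by metis
  obtain Z1 where Z1: "finite Z1" "card Z1 = Suc q" "Z1 \<subseteq> {0..real p}"
    "ddiff (G k) ((+) (t - real c) ` Z1) = T (t - real c)"
    using ddiff_newton_nodes[OF G pos(1)] unfolding T_def q_def by metis
  obtain Z2 where Z2: "finite Z2" "card Z2 = Suc q" "Z2 \<subseteq> {0..real p}"
    "ddiff (G k) ((+) (t + real c) ` Z2) = T (t + real c)"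
    using ddiff_newton_nodes[OF G pos(3)] unfolding T_def q_def by metis
  \<comment> \<open>\<open>p < c\<close> puts the nodes for \<open>t - c\<close> below \<open>t\<close>; those for \<open>t + c\<close> start at \<open>t + c\<close>.\<close>
  have between: "T (t - real c) \<le> ddiff (G k) ((+) t ` B) \<and> ddiff (G k) ((+) t ` B) \<le> T (t + real c)"
    if B: "finite B" "card B = Suc q" "B \<subseteq> {0..<real c}" for B
  proof
    have cp: "real p < real c" using c by simp
    have "ddiff (G k) ((+) (t - real c) ` Z1) \<le> ddiff (G k) ((+) t ` B)"
    proof (rule ddiff_mono_separated[OF qc])
      fix u v assume "u \<in> (+) (t - real c) ` Z1" "v \<in> (+) t ` B"
      then have "u \<le> t - real c + real p" "t \<le> v" using Z1(3) B(3) by force+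
      then show "u < v" using cp by simp
    next
      show "(+) (t - real c) ` Z1 \<subseteq> {a<..}" "(+) t ` B \<subseteq> {a<..}" using Z1(3) B(3) a by force+
    qed (use Z1 B in \<open>auto simp: card_image\<close>)
    then show "T (t - real c) \<le> ddiff (G k) ((+) t ` B)" using Z1 by simp
    have "ddiff (G k) ((+) t ` B) \<le> ddiff (G k) ((+) (t + real c) ` Z2)"
    proof (rule ddiff_mono_separated[OF qc])
      fix u v assume "u \<in> (+) t ` B" "v \<in> (+) (t + real c) ` Z2"
      then have "u < t + real c" "t + real c \<le> v" using Z2(3) B(3) by force+
      then show "u < v" by simp
    next
      show "(+) (t + real c) ` Z2 \<subseteq> {a<..}" "(+) t ` B \<subseteq> {a<..}" using Z2(3) B(3) a by force+
    qed (use Z2 B in \<open>auto simp: card_image\<close>)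
    then show "ddiff (G k) ((+) t ` B) \<le> T (t + real c)" using Z2 by simp
  qed
  have Zc: "Z \<subseteq> {0..<real c}" using Z(3) c by force
  have Tt: "T (t - real c) \<le> T t" "T t \<le> T (t + real c)" using between[OF Z(1,2) Zc] Z(5) by auto
  have "\<bar>newton_error p G k t x\<bar> \<le> real c ^ q * (T (t + real c) - T (t - real c))"
  proof (cases "x \<in> Z")
    case True
    then show ?thesis using Z(4) Tt by simp
  next
    case False
    obtain z Z' where Z': "Z = insert z Z'" "z \<notin> Z'" "finite Z'"
      using Z(1,2) by (metis card_eq_SucD finite_insert)
    have B: "finite (insert x Z')" "card (insert x Z') = Suc q" "insert x Z' \<subseteq> {0..<real c}"
      using Z' Z False Zc x by auto
    have "newton_error p G k t x / (\<Prod>b\<in>Z'. x - b) = ddiff (newton_error p G k t) (insert x Z')"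
      using Z' Z(4) False by (simp add: ddiff_insert)
    also have "\<dots> = ddiff (\<lambda>x. G k (t + x)) (insert x Z')
        - ddiff (poly ((pderiv ^^ k) (newton_poly p (G 0) t))) (insert x Z')"
      by (subst ddiff_diff[symmetric]) (simp add: newton_error_def[abs_def])
    also have "\<dots> = ddiff (G k) ((+) t ` insert x Z') - T t"
      using ddiff_newton_poly_deriv[OF G(2) B(1) B(2)[unfolded q_def]] by (simp only: ddiff_shift T_def q_def)
    finally have e: "newton_error p G k t x / (\<Prod>b\<in>Z'. x - b) = ddiff (G k) ((+) t ` insert x Z') - T t" .
    have nz: "(\<Prod>b\<in>Z'. x - b) \<noteq> 0" using Z' False by auto
    have "\<bar>newton_error p G k t x\<bar> = \<bar>\<Prod>b\<in>Z'. x - b\<bar> * \<bar>ddiff (G k) ((+) t ` insert x Z') - T t\<bar>"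
      unfolding e[symmetric] abs_mult[symmetric] using nz by simp
    also have "\<dots> \<le> real c ^ q * (T (t + real c) - T (t - real c))"
    proof (rule mult_mono)
      have "\<bar>\<Prod>b\<in>Z'. x - b\<bar> = (\<Prod>b\<in>Z'. \<bar>x - b\<bar>)" by (rule abs_prod)
      also have "\<dots> \<le> (\<Prod>b\<in>Z'. real c)"
        using Z' Zc x by (intro prod_mono) (auto simp: abs_le_iff)
      also have "\<dots> = real c ^ q" using Z' Z(2) by simp
      finally show "\<bar>\<Prod>b\<in>Z'. x - b\<bar> \<le> real c ^ q" .
      show "\<bar>ddiff (G k) ((+) t ` insert x Z') - T t\<bar> \<le> T (t + real c) - T (t - real c)"
        using between[OF B] Tt by linarith
    qed auto
    finally show ?thesis .
  qed
  then show ?thesis by (simp add: T_def q_def diff_divide_distrib right_diff_distrib)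
qed

lemma summable_shift_diff:
  fixes u :: "nat \<Rightarrow> real"
  assumes "u \<longlonglongrightarrow> l"
  shows "summable (\<lambda>n. u (n + d) - u n)"
proof (induction d)
  case (Suc d)
  have "(\<lambda>n. u (n + d)) \<longlonglongrightarrow> l" using assms by (rule LIMSEQ_ignore_initial_segment)
  then have "summable (\<lambda>n. u (Suc n + d) - u (n + d))" by (rule telescope_summable)
  from summable_add[OF this Suc] show ?case by simp
qed simp

text \<open>In the bound on the error, the increments of \<open>\<Delta>\<^sup>p g\<close> over a step of fixed length \<open>2 c\<close>
telescope, and \<open>\<Delta>\<^sup>p g(n)\<close> tends to \<open>0\<close>.\<close>
lemma newton_error_summable:
  assumes G: "deriv_chain k G" "k \<le> p"
    and K: "G 0 \<in> K_class p" and D: "G 0 \<in> D_class p"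
  shows "\<exists>M. summable M \<and> (\<forall>\<^sub>F n in sequentially. \<forall>x\<in>{0..b}. \<bar>newton_error p G k (real n) x\<bar> \<le> M n)"
proof -
  have main: "\<exists>M. summable M \<and> (\<forall>\<^sub>F n in sequentially. \<forall>x\<in>{0..b}. \<bar>newton_error p G k (real n) x\<bar> \<le> M n)"
    if G: "deriv_chain k G" and D: "G 0 \<in> D_class p" and a: "a > 0" "hconvex p {a..} (G 0)" for G a
  proof -
    \<comment> \<open>\<open>c\<close> has to exceed \<open>p\<close> and every \<open>x\<close> under consideration.\<close>
    obtain c :: nat where c: "max (real p) b < real c" using reals_Archimedean2 by blast
    define u where "u n = (fdiff ^^ p) (G 0) (real n)" for n
    \<comment> \<open>The subtraction \<open>n - c\<close> truncates only for finitely many \<open>n\<close>.\<close>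
    define M where "M n = real c ^ (p - k) / fact (p - k) * (u (n + c) - u (n - c))" for n
    have "u \<longlonglongrightarrow> 0" using D by (simp add: D_class_def u_def[abs_def])
    then have "summable (\<lambda>n. u (n + (c + c)) - u n)" by (rule summable_shift_diff)
    then have "summable (\<lambda>n. M (n + c))"
      unfolding M_def by (intro summable_mult) (simp add: add.assoc)
    then have M: "summable M" by (simp only: summable_iff_shift)
    have "\<bar>newton_error p G k (real n) x\<bar> \<le> M n"
      if "n > nat \<lceil>a\<rceil> + c" "x \<in> {0..b}" for n x
    proof -
      have n: "a + real c < real n" using that a by linarith
      have "hconvex p {a<..} (G 0)" using a(2) by (rule hconvex_subset) auto
      then have "\<bar>newton_error p G k (real n) x\<bar> \<le> real c ^ (p - k) / fact (p - k) *
          ((fdiff ^^ p) (G 0) (real n + real c) - (fdiff ^^ p) (G 0) (real n - real c))"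
        using G(1) assms(2) a n c that by (intro newton_error_bound[where a = a]) auto
      also have "\<dots> = M n"
        using that by (simp add: M_def u_def of_nat_diff)
      finally show ?thesis .
    qed
    then have "\<forall>\<^sub>F n in sequentially. \<forall>x\<in>{0..b}. \<bar>newton_error p G k (real n) x\<bar> \<le> M n"
      unfolding eventually_sequentially by (intro exI[of _ "Suc (nat \<lceil>a\<rceil> + c)"]) auto
    with M show ?thesis by blast
  qed
  obtain a where a: "a > 0" "hconvex p {a..} (G 0) \<or> hconvex p {a..} (\<lambda>x. - G 0 x)"
    using K by (auto simp: K_class_iff_hconvex)
  from a(2) show ?thesis
  proof
    assume "hconvex p {a..} (G 0)"
    then show ?thesis using main[OF G(1) D a(1)] by simp
  next
    assume h: "hconvex p {a..} (\<lambda>x. - G 0 x)"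
    have D': "(\<lambda>x. - G 0 x) \<in> D_class p"
      using D tendsto_minus[of _ 0] by (fastforce simp: D_class_def fdiff_funpow_uminus)
    show ?thesis
      using main[of "\<lambda>k x. - G k x", OF deriv_chain_uminus[OF G(1)] D' a(1) h] by (simp add: newton_error_uminus)
  qed
qed

section \<open>The approximating sequence as a series of interpolation errors\<close>

text \<open>The polynomial part of \<^const>\<open>f_approx\<close> for \<open>n \<ge> 1\<close>. Writing the constant term as
\<open>(\<Sum>i<n. g i) - g 0\<close> rather than as a sum from \<open>1\<close> makes the recursion in \<open>n\<close> hold
from \<open>n = 0\<close> on.\<close>
definition approx_poly :: "nat \<Rightarrow> (real \<Rightarrow> real) \<Rightarrow> nat \<Rightarrow> real poly" where
  "approx_poly p g n = [:(\<Sum>i<n. g (real i)) - g 0:] +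
     (\<Sum>j=1..p. smult ((fdiff ^^ (j - 1)) g (real n)) (gbinomial_poly j))"

definition approx_chain :: "nat \<Rightarrow> (nat \<Rightarrow> real \<Rightarrow> real) \<Rightarrow> nat \<Rightarrow> nat \<Rightarrow> real \<Rightarrow> real" where
  "approx_chain p G n k x = poly ((pderiv ^^ k) (approx_poly p (G 0) n)) x - (\<Sum>i<n. G k (x + real i))"

lemma f_approx_eq_chain:
  assumes "n \<ge> 1"
  shows "f_approx p n (G 0) x = approx_chain p G n 0 x"
proof -
  have *: "(\<Sum>i<n. h i) = h 0 + (\<Sum>i=1..<n. h i)" for h :: "nat \<Rightarrow> real"
    using assms by (simp add: lessThan_atLeast0 sum.atLeast_Suc_lessThan)
  show ?thesis
    unfolding f_approx_def approx_chain_def approx_poly_def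
    by (simp add: poly_sum poly_gbinomial_poly * sum_subtractf mult.commute)
qed

lemma degree_approx_poly: "degree (approx_poly p g n) \<le> p"
  unfolding approx_poly_def
  by (intro degree_add_le degree_sum_le)
    (auto intro: order.trans[OF degree_smult_le] simp: degree_gbinomial_poly)

text \<open>As \<open>\<Delta>\<^sup>j\<^sup>-\<^sup>1 g(n + 1) = \<Delta>\<^sup>j\<^sup>-\<^sup>1 g(n) + \<Delta>\<^sup>j g(n)\<close>, the terms with \<open>j \<ge> 1\<close>
contribute all of the interpolating polynomial at \<open>n\<close> except its constant term \<open>g(n)\<close>, which comes from
the constant part.\<close>
lemma approx_poly_Suc: "approx_poly p g (Suc n) = approx_poly p g n + newton_poly p g (real n)"
proof -
  have "(\<Sum>j=1..p. smult ((fdiff ^^ (j - 1)) g (real (Suc n))) (gbinomial_poly j)) =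
    (\<Sum>j=1..p. smult ((fdiff ^^ (j - 1)) g (real n)) (gbinomial_poly j) 
      + smult ((fdiff ^^ j) g (real n)) (gbinomial_poly j))"
  proof (rule sum.cong)
    fix j assume "j \<in> {1..p}"
    then have "(fdiff ^^ (j - 1)) g (real (Suc n)) = (fdiff ^^ (j - 1)) g (real n) + (fdiff ^^ j) g (real n)"
      using fdiff_Suc_add[of "j - 1" g "real n"] by (simp add: add.commute)
    then show "smult ((fdiff ^^ (j - 1)) g (real (Suc n))) (gbinomial_poly j) = 
      smult ((fdiff ^^ (j - 1)) g (real n)) (gbinomial_poly j) + smult ((fdiff ^^ j) g (real n)) (gbinomial_poly j)"
      by (simp only: smult_add_left)
  qed simp
  moreover have "newton_poly p g (real n) = [:g (real n):] + (\<Sum>j=1..p. smult ((fdiff ^^ j) g (real n)) (gbinomial_poly j))"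
  proof -
    have "{..p} = insert 0 {1..p}" by auto
    then show ?thesis by (simp add: newton_poly_def gbinomial_poly_def)
  qed
  ultimately show ?thesis
    by (simp add: approx_poly_def sum.distrib)
qed

lemma approx_chain_Suc:
  "approx_chain p G (Suc n) k x = approx_chain p G n k x - newton_error p G k (real n) x"
  by (simp add: approx_chain_def approx_poly_Suc higher_pderiv_add newton_error_def add.commute)

text \<open>Since consecutive approximations differ by an interpolation error, the convergence of the approximating
sequence and of its derivatives is that of the series of these errors.\<close>
lemma approx_chain_eq_series:
  "approx_chain p G n k x = approx_chain p G 0 k x - (\<Sum>i<n. newton_error p G k (real i) x)"
  by (induction n) (simp_all add: approx_chain_Suc)

lemma deriv_chain_approx:
  assumes "deriv_chain r G"
  shows "deriv_chain r (approx_chain p G n)"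
  unfolding deriv_chain_def
proof safe
  fix k and x :: real assume k: "k < r" "x > 0"
  have "((\<lambda>x. G k (x + real i)) has_real_derivative G (Suc k) (x + real i)) (at x)" for i
    using deriv_chainD[OF assms k(1), of "x + real i"] k DERIV_shift[of "G k" _ x "real i"] by simp
  then show "(approx_chain p G n k has_real_derivative approx_chain p G n (Suc k) x) (at x)"
    unfolding approx_chain_def[abs_def] by (auto intro!: DERIV_diff DERIV_sum poly_DERIV)
qed

definition limit_chain :: "nat \<Rightarrow> (nat \<Rightarrow> real \<Rightarrow> real) \<Rightarrow> nat \<Rightarrow> real \<Rightarrow> real" where
  "limit_chain p G k x = approx_chain p G 0 k x - (\<Sum>i. newton_error p G k (real i) x)"

text \<open>The case \<open>r \<le> p\<close>, in which the errors of all derivatives up to order \<open>r\<close> are summable.\<close>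
context
  fixes p r :: nat and G :: "nat \<Rightarrow> real \<Rightarrow> real"
  assumes G: "deriv_chain r G" and rp: "r \<le> p" and K: "G 0 \<in> K_class p" and D: "G 0 \<in> D_class p"
begin

lemma newton_error_series_uniform:
  assumes "k \<le> r"
  shows "uniform_limit {0<..<b} (\<lambda>n x. \<Sum>i<n. newton_error p G k (real i) x)
           (\<lambda>x. \<Sum>i. newton_error p G k (real i) x) sequentially"
proof -
  obtain M where M: "summable M" "\<forall>\<^sub>F n in sequentially. \<forall>x\<in>{0..b}. \<bar>newton_error p G k (real n) x\<bar> \<le> M n"
    using newton_error_summable[OF deriv_chain_mono[OF G assms] _ K D] assms rp by (meson order.trans)
  show ?thesis
    by (rule Weierstrass_m_test_ev[OF _ M(1)]) (use M(2) in \<open>auto elim!: eventually_mono\<close>)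
qed

lemma newton_error_series_summable:
  assumes "k \<le> r" "x > 0"
  shows "summable (\<lambda>i. newton_error p G k (real i) x)"
  using tendsto_uniform_limitI[OF newton_error_series_uniform[OF assms(1), of "x + 1"], of x] assms(2)
  by (simp add: sums_def[symmetric] sums_iff)

lemma approx_chain_uniform:
  assumes "k \<le> r"
  shows "uniform_limit {0<..<b} (\<lambda>n. approx_chain p G n k) (limit_chain p G k) sequentially"
proof -
  have "uniform_limit {0<..<b} (\<lambda>n x. approx_chain p G 0 k x - (\<Sum>i<n. newton_error p G k (real i) x))
      (limit_chain p G k) sequentially"
    unfolding limit_chain_def[abs_def]
    by (intro uniform_limit_minus uniform_limit_const newton_error_series_uniform assms)
  then show ?thesis by (simp only: approx_chain_eq_series[of p G _ k, symmetric])
qed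

lemma approx_chain_tendsto:
  assumes "k \<le> r" "x > 0"
  shows "(\<lambda>n. approx_chain p G n k x) \<longlonglongrightarrow> limit_chain p G k x"
  using tendsto_uniform_limitI[OF approx_chain_uniform[OF assms(1), of "x + 1"], of x] assms(2) by simp

lemma deriv_chain_limit: "deriv_chain r (limit_chain p G)"
  unfolding deriv_chain_def
proof safe
  fix k and x :: real assume k: "k < r" "x > 0"
  have d: "((\<lambda>x. \<Sum>i. newton_error p G k (real i) x) has_real_derivative (\<Sum>i. newton_error p G (Suc k) (real i) x)) (at x)"
  proof (rule has_field_derivative_series'(2)[where S = "{0<..<x + 1}" and x0 = x])
    show "uniformly_convergent_on {0<..<x + 1} (\<lambda>n x. \<Sum>i<n. newton_error p G (Suc k) (real i) x)"
      using newton_error_series_uniform[of "Suc k" "x + 1"] k unfolding uniformly_convergent_on_def by auto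
    show "(newton_error p G k (real n) has_real_derivative newton_error p G (Suc k) (real n) y) (at y within {0<..<x + 1})"
      if "y \<in> {0<..<x + 1}" for n y
      using that k by (intro has_field_derivative_at_within[OF newton_error_deriv[OF G]]) auto
    show "summable (\<lambda>n. newton_error p G k (real n) x)"
      using k by (intro newton_error_series_summable) auto
  qed (use k in \<open>auto simp: interior_open\<close>)
  show "(limit_chain p G k has_real_derivative limit_chain p G (Suc k) x) (at x)"
    unfolding limit_chain_def[abs_def]
    using deriv_chainD[OF deriv_chain_approx[OF G] k] d by (rule DERIV_diff)
qed

lemma continuous_limit_chain:
  assumes "continuous_on {0<..} (G r)"
  shows "continuous_on {0<..} (limit_chain p G r)"
proof -
  have "isCont (limit_chain p G r) x" if "x > 0" for x
  proof -
    have "continuous_on {0<..<x + 1} (limit_chain p G r)"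
    proof (rule uniform_limit_theorem[OF _ approx_chain_uniform[of r "x + 1"]])
      have "continuous_on {0<..<x + 1} (\<lambda>y. G r (y + real i))" for i
        by (rule continuous_on_compose2[OF assms]) (auto intro!: continuous_intros)
      then have "continuous_on {0<..<x + 1} (approx_chain p G n r)" for n
        unfolding approx_chain_def[abs_def] by (intro continuous_on_diff continuous_on_sum continuous_intros)
      then show "\<forall>\<^sub>F n in sequentially. continuous_on {0<..<x + 1} (approx_chain p G n r)" by simp
    qed auto
    then show ?thesis using that by (simp add: continuous_on_eq_continuous_at)
  qed
  then show ?thesis by (simp add: continuous_on_eq_continuous_at)
qed

text \<open>For the \<open>n\<close>-th approximation the difference equation fails by an interpolation error and a multiple
of \<open>\<Delta>\<^sup>p g(n)\<close>, and both tend to \<open>0\<close>.\<close>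
lemma limit_chain_fdiff:
  assumes "x > 0"
  shows "fdiff (limit_chain p G 0) x = G 0 x"
proof -
  let ?g = "G 0"
  let ?u = "\<lambda>n. (fdiff ^^ p) ?g (real n)"
  have step: "approx_chain p G n 0 (x + 1) - approx_chain p G n 0 x =
      ?g x - newton_error p G 0 (real n) x - (x gchoose p) * ?u n" for n
  proof -
    have 1: "(\<Sum>i<n. ?g (x + 1 + real i)) - (\<Sum>i<n. ?g (x + real i)) = ?g (x + real n) - ?g x"
      using sum_lessThan_telescope[of "\<lambda>i. ?g (x + real i)" n]
      by (simp add: sum_subtractf[symmetric] algebra_simps)
    have "(\<Sum>j=1..p. (fdiff ^^ (j - 1)) ?g (real n) * ((x + 1) gchoose j))
        - (\<Sum>j=1..p. (fdiff ^^ (j - 1)) ?g (real n) * (x gchoose j))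
        = (\<Sum>j=1..p. (fdiff ^^ (j - 1)) ?g (real n) * (x gchoose (j - 1)))"
      unfolding sum_subtractf[symmetric]
    proof (rule sum.cong)
      fix j assume "j \<in> {1..p}"
      then obtain i where j: "j = Suc i" by (cases j) auto
      have "(x + 1) gchoose j = (x gchoose (j - 1)) + (x gchoose j)"
        by (simp only: j gbinomial_Suc_Suc diff_Suc_1)
      then show "(fdiff ^^ (j - 1)) ?g (real n) * ((x + 1) gchoose j) - (fdiff ^^ (j - 1)) ?g (real n) * (x gchoose j)
          = (fdiff ^^ (j - 1)) ?g (real n) * (x gchoose (j - 1))"
        by (simp only: distrib_left add_diff_cancel_right')
    qed simp
    also have "\<dots> = (\<Sum>j<p. (fdiff ^^ j) ?g (real n) * (x gchoose j))"
      by (rule sum.reindex_bij_witness[of _ Suc "\<lambda>j. j - 1"]) auto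
    also have "\<dots> = poly (newton_poly p ?g (real n)) x - (x gchoose p) * ?u n"
      by (simp add: poly_newton_poly lessThan_Suc_atMost[symmetric] mult.commute)
    finally show ?thesis
      using 1 by (simp add: approx_chain_def approx_poly_def poly_sum poly_gbinomial_poly newton_error_def add.commute)
  qed
  have "(\<lambda>n. ?g x - newton_error p G 0 (real n) x - (x gchoose p) * ?u n) \<longlonglongrightarrow> ?g x - 0 - (x gchoose p) * 0"
    using D assms
    by (intro tendsto_diff tendsto_mult tendsto_const summable_LIMSEQ_zero[OF newton_error_series_summable])
      (auto simp: D_class_def)
  moreover have "(\<lambda>n. approx_chain p G n 0 (x + 1) - approx_chain p G n 0 x) \<longlonglongrightarrow>
      limit_chain p G 0 (x + 1) - limit_chain p G 0 x"
    using assms by (intro tendsto_diff approx_chain_tendsto) auto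
  ultimately have "limit_chain p G 0 (x + 1) - limit_chain p G 0 x = ?g x - 0 - (x gchoose p) * 0"
    unfolding step by (rule LIMSEQ_unique[rotated])
  then show ?thesis by (simp add: fdiff_def)
qed

text \<open>The polynomial part has degree at most \<open>p\<close>, so divided differences of order \<open>p + 1\<close> do not see
it. What is left is minus a sum of translates of \<open>g = G 0\<close>, so the limit is \<open>p\<close>-concave where
\<open>g\<close> is \<open>p\<close>-convex, and vice versa.\<close>
lemma limit_chain_K_class: "limit_chain p G 0 \<in> K_class p"
proof -
  have lim: "(\<lambda>n. - (\<Sum>i<n. ddiff (G 0) ((+) (real i) ` A))) \<longlonglongrightarrow> ddiff (limit_chain p G 0) A"
    if A: "finite A" "card A = p + 2" "A \<subseteq> {0<..}" for A
  proof -
    have "ddiff (\<lambda>x. G 0 (x + real i)) A = ddiff (G 0) ((+) (real i) ` A)" for i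
      by (subst ddiff_shift) (simp add: add.commute)
    then have "ddiff (approx_chain p G n 0) A = - (\<Sum>i<n. ddiff (G 0) ((+) (real i) ` A))" for n
      using A degree_approx_poly[of p "G 0" n]
      by (simp add: approx_chain_def[abs_def] ddiff_diff ddiff_sum ddiff_poly_eq_0)
    moreover have "(\<lambda>n. ddiff (approx_chain p G n 0) A) \<longlonglongrightarrow> ddiff (limit_chain p G 0) A"
      unfolding ddiff_def using A by (intro tendsto_intros approx_chain_tendsto) auto
    ultimately show ?thesis by simp
  qed
  obtain a where a: "a > 0" "hconvex p {a..} (G 0) \<or> hconvex p {a..} (\<lambda>x. - G 0 x)"
    using K by (auto simp: K_class_iff_hconvex)
  have shift: "(+) (real i) ` A \<subseteq> {a..} \<and> finite ((+) (real i) ` A) \<and> card ((+) (real i) ` A) = p + 2"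
    if "A \<subseteq> {a..}" "finite A" "card A = p + 2" for A i
    using that by (auto simp: card_image)
  from a(2) have "hconvex p {a..} (\<lambda>x. - limit_chain p G 0 x) \<or> hconvex p {a..} (limit_chain p G 0)"
  proof
    assume h: "hconvex p {a..} (G 0)"
    have "hconvex p {a..} (\<lambda>x. - limit_chain p G 0 x)"
      unfolding hconvex_def
    proof safe
      fix A assume A: "A \<subseteq> {a..}" "finite A" "card A = p + 2"
      have "- (\<Sum>i<n. ddiff (G 0) ((+) (real i) ` A)) \<le> 0" for n
        using h shift[OF A] unfolding hconvex_def by (simp add: sum_nonneg)
      then have "ddiff (limit_chain p G 0) A \<le> 0"
        using A a(1) by (intro LIMSEQ_le_const2[OF lim[of A]]) auto
      then show "0 \<le> ddiff (\<lambda>x. - limit_chain p G 0 x) A" by (simp add: ddiff_uminus)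
    qed
    then show ?thesis ..
  next
    assume h: "hconvex p {a..} (\<lambda>x. - G 0 x)"
    have "hconvex p {a..} (limit_chain p G 0)"
      unfolding hconvex_def
    proof safe
      fix A assume A: "A \<subseteq> {a..}" "finite A" "card A = p + 2"
      have "0 \<le> - (\<Sum>i<n. ddiff (G 0) ((+) (real i) ` A))" for n
        using h shift[OF A] unfolding hconvex_def by (simp add: sum_nonpos ddiff_uminus)
      then show "0 \<le> ddiff (limit_chain p G 0) A"
        using A a(1) by (intro LIMSEQ_le_const[OF lim[of A]]) auto
    qed
    then show ?thesis ..
  qed
  then show ?thesis using a(1) by (auto simp: K_class_iff_hconvex)
qed

end

section \<open>Independence of the order\<close>

lemma D_class_fdiff_tendsto:
  assumes "g \<in> D_class p" "p \<le> j"
  shows "(\<lambda>n. (fdiff ^^ j) g (real n)) \<longlonglongrightarrow> 0"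
  using assms(2)
proof (induction j rule: dec_induct)
  case base
  then show ?case using assms by (simp add: D_class_def)
next
  case (step j)
  have "(\<lambda>n. (fdiff ^^ j) g (real (Suc n)) - (fdiff ^^ j) g (real n)) \<longlonglongrightarrow> 0 - 0"
    using step.IH by (intro tendsto_diff LIMSEQ_Suc)
  moreover have "(fdiff ^^ j) g (real (Suc n)) - (fdiff ^^ j) g (real n) = (fdiff ^^ Suc j) g (real n)" for n
    using fdiff_Suc_add[of j g "real n"] by (simp add: add.commute)
  ultimately show ?case by simp
qed

lemma D_class_mono: "g \<in> D_class p \<Longrightarrow> p \<le> q \<Longrightarrow> g \<in> D_class q"
  using D_class_fdiff_tendsto[of g p q] by (simp add: D_class_def)

text \<open>Raising the order from \<open>p\<close> to \<open>q\<close> adds the terms \<open>j = p + 1, ..., q\<close>, whose coefficients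
\<open>\<Delta>\<^sup>j\<^sup>-\<^sup>1 g(n)\<close> tend to \<open>0\<close> and whose polynomial factors are bounded on bounded sets.\<close>
lemma approx_chain_change_order:
  assumes "G 0 \<in> D_class p" "p \<le> q" "bounded S"
  shows "uniform_limit S (\<lambda>n x. approx_chain q G n k x - approx_chain p G n k x) (\<lambda>x. 0) sequentially"
proof -
  let ?B = "\<lambda>j. (pderiv ^^ k) (gbinomial_poly j)" and ?u = "\<lambda>j n. (fdiff ^^ (j - 1)) (G 0) (real n)"
  have eq: "approx_chain q G n k x - approx_chain p G n k x = (\<Sum>j=p+1..q. ?u j n * poly (?B j) x)" for n x
  proof -
    have "{1..q} = {1..p} \<union> {p+1..q}" using assms(2) by auto
    then have "approx_poly q (G 0) n = approx_poly p (G 0) n + (\<Sum>j=p+1..q. smult (?u j n) (gbinomial_poly j))"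
      by (simp add: approx_poly_def sum.union_disjoint)
    then show ?thesis
      by (simp add: approx_chain_def higher_pderiv_add higher_pderiv_sum higher_pderiv_smult poly_sum)
  qed
  have "\<exists>b. \<forall>x\<in>S. \<bar>poly (?B j) x\<bar> \<le> b" for j
  proof -
    have "bounded (poly (?B j) ` closure S)"
      using assms(3) by (intro compact_imp_bounded compact_continuous_image) (auto intro: continuous_intros)
    then show ?thesis using closure_subset[of S] by (force simp: bounded_iff)
  qed
  then obtain b where b: "\<And>j x. x \<in> S \<Longrightarrow> \<bar>poly (?B j) x\<bar> \<le> b j" by metis
  have "(\<lambda>n. \<Sum>j=p+1..q. \<bar>?u j n\<bar> * b j) \<longlonglongrightarrow> (\<Sum>j=p+1..q. \<bar>0\<bar> * b j)"
    by (intro tendsto_intros D_class_fdiff_tendsto[OF assms(1)]) auto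
  then have lim: "(\<lambda>n. \<Sum>j=p+1..q. \<bar>?u j n\<bar> * b j) \<longlonglongrightarrow> 0" by simp
  show ?thesis
  proof (rule uniform_limitI)
    fix e :: real assume "e > 0"
    then have "\<forall>\<^sub>F n in sequentially. (\<Sum>j=p+1..q. \<bar>?u j n\<bar> * b j) < e"
      using lim by (auto dest: order_tendstoD(2))
    then show "\<forall>\<^sub>F n in sequentially. \<forall>x\<in>S. dist (approx_chain q G n k x - approx_chain p G n k x) 0 < e"
    proof (rule eventually_mono, intro ballI)
      fix n x assume n: "(\<Sum>j=p+1..q. \<bar>?u j n\<bar> * b j) < e" and x: "x \<in> S"
      have "\<bar>\<Sum>j=p+1..q. ?u j n * poly (?B j) x\<bar> \<le> (\<Sum>j=p+1..q. \<bar>?u j n\<bar> * b j)"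
        by (intro order.trans[OF sum_abs] sum_mono) (simp add: abs_mult b[OF x] mult_left_mono)
      then show "dist (approx_chain q G n k x - approx_chain p G n k x) 0 < e"
        using n by (simp add: eq)
    qed
  qed
qed

lemma f_approx_limit_change_order:
  assumes "g \<in> D_class p" "g \<in> D_class q" "(\<lambda>n. f_approx p n g x) \<longlonglongrightarrow> l"
  shows "(\<lambda>n. f_approx q n g x) \<longlonglongrightarrow> l"
proof -
  have d: "(\<lambda>n. f_approx q n g x - f_approx p n g x) \<longlonglongrightarrow> 0" if "g \<in> D_class p" "p \<le> q" for p q
  proof (rule Lim_transform_eventually)
    show "(\<lambda>n. approx_chain q (\<lambda>k. g) n 0 x - approx_chain p (\<lambda>k. g) n 0 x) \<longlonglongrightarrow> 0"
      using tendsto_uniform_limitI[OF approx_chain_change_order[of "\<lambda>k. g" p q "{x}" 0]] that by simp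
    show "\<forall>\<^sub>F n in sequentially. approx_chain q (\<lambda>k. g) n 0 x - approx_chain p (\<lambda>k. g) n 0 x
        = f_approx q n g x - f_approx p n g x"
      using eventually_ge_at_top[of 1] by eventually_elim (simp add: f_approx_eq_chain[of _ _ "\<lambda>k. g"])
  qed
  have "(\<lambda>n. f_approx q n g x - f_approx p n g x) \<longlonglongrightarrow> 0"
  proof (cases "p \<le> q")
    case False
    then show ?thesis using tendsto_minus[OF d[of q p]] assms by simp
  qed (use d assms in auto)
  from tendsto_add[OF this assms(3)] show ?thesis by simp
qed

text \<open>The order picked by the choice operator in \<^const>\<open>Sigma_op\<close> is some order \<open>q\<close> with
\<open>g\<close> in \<open>D\<^sup>q\<close>, and the limit is the same for all of these.\<close>
lemma Sigma_op_eqI: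
  assumes "g \<in> D_class p \<inter> K_class p" "(\<lambda>n. f_approx p n g x) \<longlonglongrightarrow> l"
  shows "Sigma_op g x = l"
proof -
  have "g \<in> D_class (SOME q. g \<in> D_class q \<inter> K_class q)"
    using someI[of "\<lambda>q. g \<in> D_class q \<inter> K_class q" p] assms by blast
  from f_approx_limit_change_order[OF _ this assms(2)] assms(1)
  show ?thesis unfolding Sigma_op_def by (intro limI) auto
qed

lemma fdiff_funpow_cong:
  assumes "\<And>x. x > 0 \<Longrightarrow> f x = h x" "x > 0"
  shows "(fdiff ^^ j) f x = (fdiff ^^ j) h x"
  using assms(2) by (induction j arbitrary: x) (auto simp: fdiff_def assms(1))

lemma D_class_Suc_if_fdiff:
  assumes "\<And>x. x > 0 \<Longrightarrow> fdiff f x = g x" "g \<in> D_class p"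
  shows "f \<in> D_class (Suc p)"
proof -
  have "\<forall>\<^sub>F n in sequentially. (fdiff ^^ p) g (real n) = (fdiff ^^ Suc p) f (real n)"
    using eventually_gt_at_top[of 0]
  proof eventually_elim
    fix n :: nat assume "n > 0"
    then show "(fdiff ^^ p) g (real n) = (fdiff ^^ Suc p) f (real n)"
      using fdiff_funpow_cong[OF assms(1), where j = p and x = "real n"]
      by (simp only: funpow_Suc_right o_apply of_nat_0_less_iff)
  qed
  then show ?thesis
    using assms(2) Lim_transform_eventually[of "\<lambda>n. (fdiff ^^ p) g (real n)"] by (simp add: D_class_def del: funpow.simps)
qed

lemma K_class_cong:
  assumes "\<And>x. x > 0 \<Longrightarrow> f x = h x" "f \<in> K_class p"
  shows "h \<in> K_class p"
proof -
  obtain a where a: "a > 0" "hconvex p {a..} f \<or> hconvex p {a..} (\<lambda>x. - f x)"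
    using assms(2) by (auto simp: K_class_iff_hconvex)
  have "ddiff f A = ddiff h A" if "A \<subseteq> {a..}" for A
    using that a(1) by (intro ddiff_cong assms(1)) force
  then have "hconvex p {a..} h \<or> hconvex p {a..} (\<lambda>x. - h x)"
    using a(2) by (simp add: hconvex_def ddiff_uminus)
  then show ?thesis using a(1) by (auto simp: K_class_iff_hconvex)
qed

section \<open>Differentiability and uniform convergence\<close>

theorem theorem7p5:
  fixes g :: "real \<Rightarrow> real" and r p :: nat
  assumes "g \<in> C_class r \<inter> D_class p \<inter> K_class (max p r)"
  shows "Sigma_op g \<in> C_class r \<inter> D_class (p + 1) \<inter> K_class (max p r) \<and>
         (\<forall>S. S \<subseteq> {0<..} \<and> bounded S \<longrightarrow>
            uniform_limit S (\<lambda>n. (deriv ^^ r) (f_approx p n g)) ((deriv ^^ r) (Sigma_op g)) sequentially)"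
proof -
  \<comment> \<open>The limit is studied at order \<open>m\<close>, where \<open>r \<le> m\<close>; its uniform approximation is transferred back to order \<open>p\<close>.\<close>
  define m where "m = max p r"
  define G where "G k = (deriv ^^ k) g" for k
  define L where "L = limit_chain m G"
  have G0: "G 0 = g" by (simp add: G_def)
  have G: "deriv_chain r G" and cont: "continuous_on {0<..} (G r)"
    using assms deriv_chain_higher_deriv[of g r] by (auto simp: G_def[abs_def] C_class_def)
  have pm: "p \<le> m" "r \<le> m" by (auto simp: m_def)
  have Dp: "G 0 \<in> D_class p" and D: "G 0 \<in> D_class m" and K: "G 0 \<in> K_class m"
    using assms D_class_mono[of g p m] pm by (auto simp: G0 m_def)
  note A = G pm(2) K D
  have Sigma: "Sigma_op g x = L 0 x" if "x > 0" for x
  proof (rule Sigma_op_eqI)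
    show "g \<in> D_class m \<inter> K_class m" using D K by (simp add: G0)
    show "(\<lambda>n. f_approx m n g x) \<longlonglongrightarrow> L 0 x"
    proof (rule Lim_transform_eventually)
      show "(\<lambda>n. approx_chain m G n 0 x) \<longlonglongrightarrow> L 0 x"
        unfolding L_def using approx_chain_tendsto[OF A] that by simp
      show "\<forall>\<^sub>F n in sequentially. approx_chain m G n 0 x = f_approx m n g x"
        using eventually_ge_at_top[of 1] by eventually_elim (simp add: f_approx_eq_chain[of _ _ G, unfolded G0])
    qed
  qed
  have chain: "deriv_chain r L" unfolding L_def by (rule deriv_chain_limit[OF A])
  have "Sigma_op g \<in> C_class r"
    using chain _ Sigma by (rule C_class_chainI) (unfold L_def, rule continuous_limit_chain[OF A cont])
  moreover have "Sigma_op g \<in> D_class (p + 1)"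
  proof -
    have "fdiff (Sigma_op g) x = g x" if "x > 0" for x
      using limit_chain_fdiff[OF A that] that by (simp add: fdiff_def Sigma L_def G0)
    then show ?thesis using D_class_Suc_if_fdiff[of "Sigma_op g" g p] Dp by (simp add: G0)
  qed
  moreover have "Sigma_op g \<in> K_class (max p r)"
    using K_class_cong[OF Sigma[symmetric]] limit_chain_K_class[OF A] by (simp add: L_def m_def)
  moreover have "uniform_limit S (\<lambda>n. (deriv ^^ r) (f_approx p n g)) ((deriv ^^ r) (Sigma_op g)) sequentially"
    if S: "S \<subseteq> {0<..}" "bounded S" for S
  proof -
    obtain b where "S \<subseteq> {0<..<b}"
    proof -
      obtain c where "\<And>x. x \<in> S \<Longrightarrow> \<bar>x\<bar> \<le> c" using S(2) by (auto simp: bounded_iff)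
      then show ?thesis using S(1) by (intro that[of "c + 1"]) force
    qed
    then have 1: "uniform_limit S (\<lambda>n. approx_chain m G n r) (L r) sequentially"
      unfolding L_def using approx_chain_uniform[OF A] uniform_limit_on_subset by blast
    have 2: "uniform_limit S (\<lambda>n x. approx_chain m G n r x - approx_chain p G n r x) (\<lambda>x. 0) sequentially"
      by (rule approx_chain_change_order[where G = G, OF Dp pm(1) S(2)])
    have 3: "uniform_limit S (\<lambda>n. approx_chain p G n r) (L r) sequentially"
      using uniform_limit_minus[OF 1 2] by simp
    have 4: "\<forall>\<^sub>F n in sequentially. \<forall>x\<in>S. approx_chain p G n r x = (deriv ^^ r) (f_approx p n g) x"
      using eventually_ge_at_top[of 1]
    proof eventually_elim
      fix n :: nat assume "n \<ge> 1"
      then show "\<forall>x\<in>S. approx_chain p G n r x = (deriv ^^ r) (f_approx p n g) x"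
        using S(1) by (intro ballI higher_deriv_eq_chain[OF deriv_chain_approx[OF G], symmetric])
          (auto simp: f_approx_eq_chain[of _ _ G, unfolded G0])
    qed
    have 5: "L r x = (deriv ^^ r) (Sigma_op g) x" if "x \<in> S" for x
    proof -
      have "x > 0" using S(1) that by auto
      then show ?thesis using higher_deriv_eq_chain[OF chain Sigma order.refl] by simp
    qed
    show ?thesis
      using uniform_limit_cong[OF 4, of "L r" "(deriv ^^ r) (Sigma_op g)"] 5 3 by blast
  qed
  ultimately show ?thesis by blast
qed

end
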